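(* Let $k,t,s$ be positive integers with $t\ge s$ and set $q=(k-1)\sum_{n=s}^{t}k^{-n}$. Then $(1,\;k^{-s+t}(k^s+k),\;k^{s-1})$ is a length $3$ half-relation for $q$.
   Context: For $q\in\mathbb{R}$ let $A=\begin{pmatrix}1&1\\0&1\end{pmatrix}$ and $B_q=\begin{pmatrix}1&0\\ q&1\end{pmatrix}$. A tuple $(a_1,a_2,a_3)\in\mathbb{Z}^3$ with all $a_i\neq 0$ is a (length $3$) half-relation for $q$ if the matrix $M=A^{a_1}B_q^{a_2}A^{a_3}$ satisfies $q\,c_{12}(M)-c_{21}(M)=0$, where $c_{ij}(M)$ is the $(i,j)$ entry of $M$. *)

theory Defs
  imports "HOL-Analysis.Analysis"
begin

text \<open>Integer powers of a square matrix; for negative exponents this is meaningful only if the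
  matrix is invertible, which both generators below are.\<close>

definition matrix_zpow :: "real^'n^'n \<Rightarrow> int \<Rightarrow> real^'n^'n" where
  "matrix_zpow M a =
     (if 0 \<le> a then (((**) M) ^^ nat a) (mat 1)
      else (((**) (matrix_inv M)) ^^ nat (- a)) (mat 1))"

definition gen_A :: "real^2^2" where
  "gen_A = vector [vector [1, 1], vector [0, 1]]"

definition gen_B :: "real \<Rightarrow> real^2^2" where
  "gen_B q = vector [vector [1, 0], vector [q, 1]]"

definition half_relation3 :: "real \<Rightarrow> int \<times> int \<times> int \<Rightarrow> bool" where
  "half_relation3 q = (\<lambda>(a1, a2, a3).
     a1 \<noteq> 0 \<and> a2 \<noteq> 0 \<and> a3 \<noteq> 0 \<and>
     (let M = matrix_zpow gen_A a1 ** matrix_zpow (gen_B q) a2 ** matrix_zpow gen_A a3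
      in q * (M $ 1 $ 2) - M $ 2 $ 1 = 0))"

end

theory Submission
  imports Defs
begin

text \<open>
  Both generators are unipotent, so the three matrix powers are explicit and the condition for
  \<open>(a, b, c)\<close> to be a half-relation becomes the vanishing of
  \<open>q * (a + c + a * c * q * b - b)\<close> (lemma \<open>half_relation3_nonneg_iff\<close>).

  The number \<open>q\<close> is a geometric sum: it telescopes to \<open>k^(1 - s) - k^(-t)\<close>, which without
  denominators reads \<open>q * k^t = k^(t - s + 1) - 1\<close> (lemma \<open>scaled_geometric_sum\<close>). Put
  \<open>K = k^(t - s)\<close> and \<open>p = k^(s - 1)\<close>. The tuple is then \<open>a = 1\<close>, \<open>b = K * k * (p + 1)\<close>,
  \<open>c = p\<close>, and \<open>k^t = K * k * p\<close>, so \<open>c * q * b = (p + 1) * (q * k^t) = (p + 1) * (K * k - 1)\<close>.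
  This is \<open>b - (p + 1) = b - c - a\<close>, and the second factor above vanishes.
\<close>

lemma matrix_zpow_gen_A_of_nat:
  "matrix_zpow gen_A (int n) = vector [vector [1, real n], vector [0, 1]]"
proof -
  have "(((**) gen_A) ^^ n) (mat 1) = vector [vector [1, real n], vector [0, 1]]"
    by (induction n)
      (simp_all add: gen_A_def vec_eq_iff forall_2 mat_def matrix_matrix_mult_def sum_2)
  then show ?thesis by (simp add: matrix_zpow_def)
qed

lemma matrix_zpow_gen_B_of_nat:
  "matrix_zpow (gen_B q) (int n) = vector [vector [1, 0], vector [real n * q, 1]]"
proof -
  have "(((**) (gen_B q)) ^^ n) (mat 1) = vector [vector [1, 0], vector [real n * q, 1]]"
    by (induction n)
      (simp_all add: gen_B_def vec_eq_iff forall_2 mat_def matrix_matrix_mult_def sum_2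
        algebra_simps)
  then show ?thesis by (simp add: matrix_zpow_def)
qed

text \<open>The relevant entries of the product are \<open>c * (1 + a * q * b) + a\<close> above the diagonal and
  \<open>q * b\<close> below it, so a factor \<open>q\<close> splits off from the half-relation condition.\<close>

lemma half_relation3_nonneg_iff:
  "half_relation3 q (int a, int b, int c) \<longleftrightarrow>
     a \<noteq> 0 \<and> b \<noteq> 0 \<and> c \<noteq> 0 \<and>
     q * (real a + real c + real a * real c * q * real b - real b) = 0"
  by (simp add: half_relation3_def matrix_zpow_gen_A_of_nat matrix_zpow_gen_B_of_nat
      matrix_matrix_mult_def sum_2 algebra_simps)

text \<open>Scaling by \<open>x^t\<close> clears all denominators and leaves the finite geometric series
  \<open>(x - 1) * (1 + x + \<dots> + x^(t - s))\<close>.\<close>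

lemma scaled_geometric_sum:
  fixes x :: real
  assumes "x \<noteq> 0" and "s \<le> t"
  shows "(x - 1) * (\<Sum>n = s..t. x powi (- int n)) * x ^ t = x ^ (t - s) * x - 1"
  using \<open>s \<le> t\<close>
proof (induction t rule: dec_induct)
  case base
  show ?case using \<open>x \<noteq> 0\<close> by (simp add: power_int_minus)
next
  case (step t)
  let ?S = "\<Sum>n = s..t. x powi (- int n)"
  have inv: "x powi (- int (Suc t)) * x ^ Suc t = 1"
    using \<open>x \<noteq> 0\<close> unfolding power_int_minus power_int_of_nat
    by (intro left_inverse) simp
  have "(x - 1) * (\<Sum>n = s..Suc t. x powi (- int n)) * x ^ Suc t
      = (x - 1) * (?S + x powi (- int (Suc t))) * x ^ Suc t"
    using step.hyps by simp
  also have "\<dots> = ((x - 1) * ?S * x ^ t) * x + (x - 1) * (x powi (- int (Suc t)) * x ^ Suc t)"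
    by (simp only: power_Suc) (simp only: algebra_simps)
  also have "\<dots> = (x ^ (t - s) * x - 1) * x + (x - 1)"
    by (simp only: step.IH inv mult_1_right)
  also have "\<dots> = x ^ (Suc t - s) * x - 1"
    using step.hyps by (simp add: Suc_diff_le algebra_simps)
  finally show ?case .
qed

theorem proposition4p1:
  fixes k t s :: nat and q :: real
  assumes "k > 0" and "t > 0" and "s > 0" and "t \<ge> s"
    and "q = (real k - 1) * (\<Sum>n = s..t. real k powi (- int n))"
  shows "half_relation3 q (1, int k ^ (t - s) * (int k ^ s + int k), int k ^ (s - 1))"
proof -
  define K p where "K = k ^ (t - s)" and "p = k ^ (s - 1)"
  have ks: "k ^ s = p * k"
    using \<open>s > 0\<close> unfolding p_def by (rule power_minus_mult[symmetric])
  have "k ^ t = K * (p * k)"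
    using \<open>t \<ge> s\<close> unfolding K_def ks[symmetric] by (simp flip: power_add)
  then have kt: "real k ^ t = real K * (real p * real k)"
    by (metis of_nat_mult of_nat_power)
  have "q * real k ^ t = real k ^ (t - s) * real k - 1"
    using scaled_geometric_sum[of "real k" s t] assms by simp
  then have tel: "q * (real K * (real p * real k)) = real K * real k - 1"
    by (simp add: kt K_def)
  have "1 + real p + real p * q * (real K * (real p * real k + real k))
      = (real p + 1) * (q * (real K * (real p * real k)) + 1)"
    by (simp add: algebra_simps)
  also have "\<dots> = real K * (real p * real k + real k)"
    unfolding tel by (simp add: algebra_simps)
  finally have "half_relation3 q (int 1, int (K * (p * k + k)), int p)"
    using \<open>k > 0\<close> unfolding half_relation3_nonneg_iff by (simp add: K_def p_def)
  moreover have "int (K * (p * k + k)) = int k ^ (t - s) * (int k ^ s + int k)"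
    by (simp add: K_def flip: ks)
  ultimately show ?thesis
    by (simp add: p_def)
qed

end
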